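(* Let $\alpha>0$ and $\hat\alpha>0$. In the random-order secretary problem with an $\alpha$-power signal (defined in the context), the policy $\mathcal{A}(\max\{S,k_n\})$ with $k_n=\lceil\beta^\star(\hat\alpha)\,n\rceil$ has asymptotic success probability (as $n\to\infty$) at least $$g(\alpha,\hat\alpha)=\begin{cases}\dfrac{\alpha}{\alpha+1}+\dfrac{1-\alpha}{\alpha}(1-\hat\alpha)^{1/\hat\alpha}-\dfrac{(1-\hat\alpha)^{(\alpha+1)/\hat\alpha}}{\alpha(\alpha+1)}, & 0<\hat\alpha\le 1,\\[2ex] \dfrac{\alpha}{\alpha+1}, & \hat\alpha\ge 1.\end{cases}$$ In particular, if $\hat\alpha\le\alpha$, then $g(\alpha,\hat\alpha)\ge\mathrm{OPT}(\hat\alpha)\ge\frac1e$.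
   Context: Notation: $[n]=\{1,\dots,n\}$. Random-order secretary problem with an $\alpha$-power signal ($\alpha>0$ a real parameter): $n$ items with distinct values arrive one by one at times $1,\dots,n$ in uniformly random order. Let $I\in[n]$ be the arrival time of the best item (so $I$ is uniform on $[n]$). After the arrival order has been fixed, a signal time $S\in[I]$ is drawn, depending on the order only through $I$, with $$\Pr[S=s\mid I=i]=\frac{s^\alpha-(s-1)^\alpha}{i^\alpha},\qquad s\in[i].$$ At each time $t$ the policy observes the relative rank of the item arriving at time $t$ among the first $t$ items, and whether the signal occurs at time $t$ ($S=t$); it then irrevocably decides whether to stop at time $t$. A policy succeeds if it stops exactly at time $I$. A time is a record if the item arriving then is the best item so far. The threshold policy $\mathcal{A}(k)$ rejects all items before time $k$ and then accepts the first record from time $k$ onward (including time $k$); thus $\mathcal{A}(\max\{S,k\})$ accepts the first record at a time $\ge\max\{S,k\}$ (for $k=0$ this is $\mathcal{A}(S)$). For $\alpha>0$, $\beta^\star(\alpha)$ denotes the maximizer over $\beta\in[0,1]$ of $$f(\alpha,\beta)=\frac{\alpha}{\alpha+1}+\frac{1-\alpha}{\alpha}\beta-\frac{\beta^{\alpha+1}}{\alpha(\alpha+1)},$$ explicitly $\beta^\star(\alpha)=(1-\alpha)^{1/\alpha}$ if $0<\alpha<1$ and $\beta^\star(\alpha)=0$ if $\alpha\ge1$. $\mathrm{OPT}(\alpha):=\frac{\alpha+(1-\alpha)^{1+1/\alpha}}{\alpha+1}$ for $0<\alpha<1$ and $\mathrm{OPT}(\alpha):=\frac{\alpha}{\alpha+1}$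 for $\alpha\ge1$. "Asymptotic success probability at least $g$" means that the $\liminf_{n\to\infty}$ of the success probabilities on instances of length $n$ (with $\alpha,\hat\alpha$ fixed) is at least $g$. *)

theory Defs
  imports "HOL-Probability.Probability" "HOL-Combinatorics.Permutations"
begin

text \<open>
  Items and times are both indexed by \<open>{1..n}\<close>. Item \<open>j\<close> has value \<open>v j\<close>, and the arrival order
  \<open>\<sigma>\<close> maps each time to the item arriving then.
\<close>

definition best_time :: "nat \<Rightarrow> (nat \<Rightarrow> real) \<Rightarrow> (nat \<Rightarrow> nat) \<Rightarrow> nat" where
  "best_time n v \<sigma> = arg_max_on (\<lambda>t. v (\<sigma> t)) {1..n}"

definition is_record :: "(nat \<Rightarrow> real) \<Rightarrow> (nat \<Rightarrow> nat) \<Rightarrow> nat \<Rightarrow> bool" where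
  "is_record v \<sigma> t \<longleftrightarrow> (\<forall>u\<in>{1..<t}. v (\<sigma> u) < v (\<sigma> t))"

text \<open>Relative rank 1 means best so far.\<close>

definition relative_rank :: "(nat \<Rightarrow> real) \<Rightarrow> (nat \<Rightarrow> nat) \<Rightarrow> nat \<Rightarrow> nat" where
  "relative_rank v \<sigma> t = card {u \<in> {1..t}. v (\<sigma> t) \<le> v (\<sigma> u)}"

lemma relative_rank_eq_1_iff:
  assumes "1 \<le> t"
  shows "relative_rank v \<sigma> t = 1 \<longleftrightarrow> is_record v \<sigma> t"
proof -
  let ?A = "{u \<in> {1..t}. v (\<sigma> t) \<le> v (\<sigma> u)}"
  have t: "t \<in> ?A" using assms by auto
  have "card A = 1 \<longleftrightarrow> A = {t}" if "t \<in> A" for A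
    using that by (auto simp: card_1_singleton_iff)
  from this[OF t] have "card ?A = 1 \<longleftrightarrow> ?A = {t}" .
  also have "\<dots> \<longleftrightarrow> is_record v \<sigma> t"
  proof
    assume A: "?A = {t}"
    show "is_record v \<sigma> t"
      unfolding is_record_def
    proof
      fix u assume u: "u \<in> {1..<t}"
      then have "u \<notin> ?A" unfolding A by auto
      then show "v (\<sigma> u) < v (\<sigma> t)" using u by auto
    qed
  next
    assume R: "is_record v \<sigma> t"
    have "u = t" if "u \<in> ?A" for u
    proof (rule ccontr)
      assume "u \<noteq> t"
      then have "u \<in> {1..<t}" using that by simp
      then show False using R that unfolding is_record_def by fastforce
    qed
    then show "?A = {t}" using t by blast
  qed
  finally show ?thesis unfolding relative_rank_def .
qed

text \<open>
  The signal distribution given that the best item arrives at time \<open>i\<close>; it is meaningful for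
  \<open>\<alpha> > 0\<close> and \<open>i \<ge> 1\<close>. Note that \<open>0 powr \<alpha> = 0\<close>.
\<close>

definition signal_pmf :: "real \<Rightarrow> nat \<Rightarrow> nat pmf" where
  "signal_pmf \<alpha> i = embed_pmf (\<lambda>s. if s \<in> {1..i}
     then (real s powr \<alpha> - (real s - 1) powr \<alpha>) / real i powr \<alpha> else 0)"

lemma pmf_signal_pmf:
  assumes "\<alpha> > 0" "i \<ge> 1"
  shows "pmf (signal_pmf \<alpha> i) s = (if s \<in> {1..i}
     then (real s powr \<alpha> - (real s - 1) powr \<alpha>) / real i powr \<alpha> else 0)"
proof -
  let ?p = "\<lambda>s. if s \<in> {1..i}
     then (real s powr \<alpha> - (real s - 1) powr \<alpha>) / real i powr \<alpha> else 0"
  have nonneg: "0 \<le> ?p s" for s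
    using assms by (auto intro!: divide_nonneg_nonneg powr_mono2)
  have tele: "(\<Sum>s=1..m. real s powr \<alpha> - (real s - 1) powr \<alpha>) = real m powr \<alpha>" for m
    using assms by (induction m) (auto simp: algebra_simps)
  have "(\<Sum>s=1..i. ?p s) = (\<Sum>s=1..i. real s powr \<alpha> - (real s - 1) powr \<alpha>) / real i powr \<alpha>"
    by (simp add: sum_divide_distrib)
  also have "\<dots> = 1" unfolding tele using assms by simp
  finally have sum1: "(\<Sum>s=1..i. ?p s) = 1" .
  have "(\<integral>\<^sup>+ s. ennreal (?p s) \<partial>count_space UNIV) = (\<Sum>s\<in>{1..i}. ennreal (?p s))"
    by (rule nn_integral_count_space') auto
  also have "\<dots> = 1" unfolding sum_ennreal[OF nonneg] sum1 by simp
  finally show ?thesis unfolding signal_pmf_def by (intro pmf_embed_pmf nonneg)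
qed

definition instance_pmf :: "real \<Rightarrow> nat \<Rightarrow> (nat \<Rightarrow> real) \<Rightarrow> ((nat \<Rightarrow> nat) \<times> nat) pmf" where
  "instance_pmf \<alpha> n v =
     bind_pmf (pmf_of_set {\<sigma>. \<sigma> permutes {1..n}}) (\<lambda>\<sigma>.
       map_pmf (Pair \<sigma>) (signal_pmf \<alpha> (best_time n v \<sigma>)))"

text \<open>
  A policy decides from the observations made so far whether to stop at the current time; the
  current time is the length of the history. Each observation consists of a relative rank and of
  whether the signal occurs.
\<close>

type_synonym policy = "(nat \<times> bool) list \<Rightarrow> bool"

definition history :: "(nat \<Rightarrow> real) \<Rightarrow> (nat \<Rightarrow> nat) \<Rightarrow> nat \<Rightarrow> nat \<Rightarrow> (nat \<times> bool) list" where
  "history v \<sigma> s t = map (\<lambda>u. (relative_rank v \<sigma> u, s = u)) [1..<Suc t]"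

definition stops_at ::
  "policy \<Rightarrow> nat \<Rightarrow> (nat \<Rightarrow> real) \<Rightarrow> (nat \<Rightarrow> nat) \<Rightarrow> nat \<Rightarrow> nat \<Rightarrow> bool" where
  "stops_at P n v \<sigma> s t \<longleftrightarrow>
     t \<in> {1..n} \<and> P (history v \<sigma> s t) \<and> (\<forall>u\<in>{1..<t}. \<not> P (history v \<sigma> s u))"

definition success_prob :: "real \<Rightarrow> nat \<Rightarrow> (nat \<Rightarrow> real) \<Rightarrow> policy \<Rightarrow> real" where
  "success_prob \<alpha> n v P =
     measure_pmf.prob (instance_pmf \<alpha> n v) {(\<sigma>, s). stops_at P n v \<sigma> s (best_time n v \<sigma>)}"

text \<open>
  The policy \<open>\<A>(max {S, k})\<close>, written as an online rule: \<open>S\<close> is the entry of the history at which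
  the signal occurs, and before time \<open>S\<close> the policy cannot stop. The lemma below confirms that it
  accepts the first record at a time \<open>\<ge> max {S, k}\<close>.
\<close>

definition signal_threshold_policy :: "nat \<Rightarrow> policy" where
  "signal_threshold_policy k h \<longleftrightarrow>
     (\<exists>S\<in>{1..length h}. snd (h ! (S - 1)) \<and> max S k \<le> length h) \<and> fst (last h) = 1"

lemma signal_threshold_policy_history:
  assumes "1 \<le> s" "1 \<le> t"
  shows "signal_threshold_policy k (history v \<sigma> s t) \<longleftrightarrow> max s k \<le> t \<and> is_record v \<sigma> t"
proof -
  have len: "length (history v \<sigma> s t) = t" by (simp add: history_def)
  have last: "fst (last (history v \<sigma> s t)) = relative_rank v \<sigma> t"
    using assms by (simp add: history_def)
  have nth: "snd (history v \<sigma> s t ! (S - 1)) \<longleftrightarrow> S = s" if "S \<in> {1..t}" for S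
    using that by (auto simp: history_def nth_append simp del: upt_Suc)
  show ?thesis
    unfolding signal_threshold_policy_def len last relative_rank_eq_1_iff[OF assms(2)]
    using assms nth by auto
qed

lemma stops_at_signal_threshold_policy:
  assumes "1 \<le> s"
  shows "stops_at (signal_threshold_policy k) n v \<sigma> s t \<longleftrightarrow>
    t \<in> {1..n} \<and> max s k \<le> t \<and> is_record v \<sigma> t \<and>
    (\<forall>u\<in>{1..<t}. max s k \<le> u \<longrightarrow> \<not> is_record v \<sigma> u)"
  using assms by (auto simp: stops_at_def signal_threshold_policy_history)

definition threshold_value :: "real \<Rightarrow> real \<Rightarrow> real" where
  "threshold_value \<alpha> \<beta> =
     \<alpha> / (\<alpha> + 1) + (1 - \<alpha>) / \<alpha> * \<beta> - \<beta> powr (\<alpha> + 1) / (\<alpha> * (\<alpha> + 1))"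

definition beta_star :: "real \<Rightarrow> real" where
  "beta_star \<alpha> = arg_max_on (threshold_value \<alpha>) {0..1}"

lemma threshold_value_less:
  fixes \<alpha> \<beta> :: real
  defines "c \<equiv> if \<alpha> < 1 then (1 - \<alpha>) powr (1 / \<alpha>) else 0"
  assumes "\<alpha> > 0" "\<beta> \<ge> 0" "\<beta> \<noteq> c"
  shows "threshold_value \<alpha> \<beta> < threshold_value \<alpha> c"
proof -
  have c0: "c \<ge> 0" by (simp add: c_def)
  have D: "(threshold_value \<alpha> has_real_derivative (1 - \<alpha> - z powr \<alpha>) / \<alpha>) (at z)" if "z > 0" for z
  proof -
    have "((\<lambda>x. x powr (\<alpha> + 1)) has_real_derivative (\<alpha> + 1) * z powr \<alpha>) (at z)"
      using has_real_derivative_powr[OF that, of "\<alpha> + 1"] by simp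
    then have "(threshold_value \<alpha> has_real_derivative
        0 + (1 - \<alpha>) / \<alpha> * 1 - (\<alpha> + 1) * z powr \<alpha> / (\<alpha> * (\<alpha> + 1))) (at z)"
      unfolding threshold_value_def
      by (intro DERIV_add DERIV_diff DERIV_const DERIV_cmult DERIV_ident DERIV_cdivide)
    moreover have "(\<alpha> + 1) * z powr \<alpha> / (\<alpha> * (\<alpha> + 1)) = z powr \<alpha> / \<alpha>"
      using assms by simp
    ultimately show ?thesis by (simp add: diff_divide_distrib)
  qed
  have C: "continuous_on {a..b} (threshold_value \<alpha>)" if "a \<ge> 0" for a b
    unfolding threshold_value_def using assms that
    by (intro continuous_intros continuous_on_powr') auto
  have mvt: "\<exists>z. a < z \<and> z < b \<and>
      threshold_value \<alpha> b - threshold_value \<alpha> a = (b - a) * ((1 - \<alpha> - z powr \<alpha>) / \<alpha>)"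
    if ab: "a < b" "0 \<le> a" for a b
  proof -
    have "threshold_value \<alpha> differentiable (at x)" if "a < x" for x
      using D[of x] that ab by (auto simp: real_differentiable_def)
    then obtain l z where z: "a < z" "z < b"
      "(threshold_value \<alpha> has_real_derivative l) (at z)"
      "threshold_value \<alpha> b - threshold_value \<alpha> a = (b - a) * l"
      using MVT[OF ab(1) C[OF ab(2)]] by blast
    moreover have "l = (1 - \<alpha> - z powr \<alpha>) / \<alpha>"
      by (rule DERIV_unique[OF z(3) D]) (use z ab in linarith)
    ultimately show ?thesis by blast
  qed
  have cp: "c powr \<alpha> = 1 - \<alpha>" if "\<alpha> < 1"
    using that assms by (simp add: c_def powr_powr)
  consider "c < \<beta>" | "\<beta> < c" using assms by linarith
  then show ?thesis
  proof cases
    case 1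
    obtain z where z: "c < z" "z < \<beta>"
      "threshold_value \<alpha> \<beta> - threshold_value \<alpha> c = (\<beta> - c) * ((1 - \<alpha> - z powr \<alpha>) / \<alpha>)"
      using mvt[OF 1 c0] by auto
    have "1 - \<alpha> < z powr \<alpha>"
    proof (cases "\<alpha> < 1")
      case True
      then show ?thesis using cp powr_less_mono2[of \<alpha> c z] z c0 assms by auto
    next
      case False
      moreover have "z powr \<alpha> > 0" using z c0 by simp
      ultimately show ?thesis by linarith
    qed
    then have "(\<beta> - c) * ((1 - \<alpha> - z powr \<alpha>) / \<alpha>) < 0"
      using 1 assms by (intro mult_pos_neg divide_neg_pos) auto
    then show ?thesis using z by linarith
  next
    case 2
    obtain z where z: "\<beta> < z" "z < c"
      "threshold_value \<alpha> c - threshold_value \<alpha> \<beta> = (c - \<beta>) * ((1 - \<alpha> - z powr \<alpha>) / \<alpha>)"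
      using mvt[OF 2] assms by auto
    have "\<alpha> < 1" using 2 assms by (auto simp: c_def split: if_splits)
    then have "z powr \<alpha> < 1 - \<alpha>" using cp powr_less_mono2[of \<alpha> z c] z assms by auto
    then have "(c - \<beta>) * ((1 - \<alpha> - z powr \<alpha>) / \<alpha>) > 0"
      using 2 assms by (intro mult_pos_pos divide_pos_pos) auto
    then show ?thesis using z by linarith
  qed
qed

lemma beta_star_eq:
  assumes "\<alpha> > 0"
  shows "beta_star \<alpha> = (if \<alpha> < 1 then (1 - \<alpha>) powr (1 / \<alpha>) else 0)" (is "_ = ?c")
proof -
  have c: "?c \<in> {0..1}" using assms by (auto intro: powr_le1)
  have *: "is_arg_max (threshold_value \<alpha>) (\<lambda>\<beta>. \<beta> \<in> {0..1}) \<beta> \<longleftrightarrow> \<beta> = ?c" for \<beta>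
  proof
    assume B: "is_arg_max (threshold_value \<alpha>) (\<lambda>\<beta>. \<beta> \<in> {0..1}) \<beta>"
    then have "\<not> threshold_value \<alpha> \<beta> < threshold_value \<alpha> ?c" "\<beta> \<ge> 0"
      using c unfolding is_arg_max_def by auto
    then show "\<beta> = ?c" using threshold_value_less[OF assms, of \<beta>] by blast
  next
    assume B: "\<beta> = ?c"
    have "\<not> threshold_value \<alpha> ?c < threshold_value \<alpha> y" if "y \<in> {0..1}" for y
    proof (cases "y = ?c")
      case False
      have "threshold_value \<alpha> y < threshold_value \<alpha> ?c"
        using that False by (intro threshold_value_less[OF assms]) auto
      then show ?thesis by linarith
    qed simp
    then show "is_arg_max (threshold_value \<alpha>) (\<lambda>\<beta>. \<beta> \<in> {0..1}) \<beta>"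
      unfolding B is_arg_max_def using c by blast
  qed
  show ?thesis
    unfolding beta_star_def arg_max_on_def arg_max_def * by (rule some_eq_trivial)
qed

definition OPT :: "real \<Rightarrow> real" where
  "OPT \<alpha> = (if \<alpha> < 1 then (\<alpha> + (1 - \<alpha>) powr (1 + 1 / \<alpha>)) / (\<alpha> + 1) else \<alpha> / (\<alpha> + 1))"

text \<open>\<open>\<gamma>\<close> plays the role of \<open>\<alpha>\<close>-hat. The two cases agree at \<open>\<gamma> = 1\<close>.\<close>

definition guarantee :: "real \<Rightarrow> real \<Rightarrow> real" where
  "guarantee \<alpha> \<gamma> = (if \<gamma> \<le> 1
     then \<alpha> / (\<alpha> + 1) + (1 - \<alpha>) / \<alpha> * (1 - \<gamma>) powr (1 / \<gamma>)
            - (1 - \<gamma>) powr ((\<alpha> + 1) / \<gamma>) / (\<alpha> * (\<alpha> + 1))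
     else \<alpha> / (\<alpha> + 1))"

lemma guarantee_ge_1: "\<gamma> \<ge> 1 \<Longrightarrow> guarantee \<alpha> \<gamma> = \<alpha> / (\<alpha> + 1)"
  by (auto simp: guarantee_def)

end

theory Submission
  imports Defs "HOL-Analysis.Harmonic_Numbers"
begin

text \<open>
  Given that the best item arrives at time \<open>i\<close>, the best of the first \<open>i - 1\<close> items is at a uniform
  position, independently of the signal. For \<open>m = max S k \<le> i\<close> the policy therefore succeeds with
  probability \<open>(m - 1) / (i - 1) \<ge> (m - 1) / i\<close>. Since \<open>S / i\<close> stochastically dominates a variable
  with distribution function \<open>x powr \<alpha>\<close> on \<open>[0, 1]\<close>, the expectation of \<open>m / i\<close> is at least
  \<open>(\<alpha> + (k / i) powr (\<alpha> + 1)) / (\<alpha> + 1)\<close>. Averaging over \<open>i\<close> and comparing the sum with an integral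
  gives at least the threshold value at \<open>k / n\<close>, up to an error \<open>harm n / n\<close>.

  The guarantee is the threshold value of \<open>\<alpha>\<close> at the maximizer for \<open>\<gamma>\<close>. For fixed \<open>\<beta>\<close> the derivative
  \<open>(1 - \<beta> powr \<alpha>) / \<alpha> - 1\<close> in \<open>\<beta>\<close> decreases in \<open>\<alpha>\<close> and the threshold value vanishes at \<open>\<beta> = 1\<close>,
  so the threshold value is monotone in \<open>\<alpha>\<close>. Finally, the optimum is at least the threshold value
  at \<open>\<beta> = 1 / e\<close>.
\<close>

subsection \<open>Threshold values\<close>

text \<open>For r \<le> 0 this combines ln x \<le> x - 1 with 1 + y \<le> exp y at y = r * ln x. For
  r \<ge> 1 the first case is applied to 1 / x with exponent 1 - r and multiplied by x.\<close>

lemma one_plus_le_powr: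
  fixes x r :: real
  assumes "x > 0" "r \<le> 0 \<or> r \<ge> 1"
  shows "1 + r * (x - 1) \<le> x powr r"
proof -
  have neg: "1 + r * (x - 1) \<le> x powr r" if "x > 0" "r \<le> 0" for x r :: real
  proof -
    have "1 + r * (x - 1) \<le> 1 + r * ln x"
      using ln_le_minus_one[OF that(1)] that(2) by (simp add: mult_left_mono_neg)
    also have "\<dots> \<le> x powr r"
      using exp_ge_add_one_self[of "r * ln x"] that(1) by (simp add: powr_def)
    finally show ?thesis .
  qed
  show ?thesis
  proof (cases "r \<le> 0")
    case False
    then have "1 + (1 - r) * (1 / x - 1) \<le> (1 / x) powr (1 - r)"
      using assms by (intro neg) auto
    then have "x * (1 + (1 - r) * (1 / x - 1)) \<le> x * (1 / x) powr (1 - r)"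
      using assms by (intro mult_left_mono) auto
    moreover have "x * (1 / x) powr (1 - r) = x powr r"
      using assms by (simp add: powr_divide powr_diff)
    moreover have "x * (1 + (1 - r) * (1 / x - 1)) = 1 + r * (x - 1)"
      using assms by (simp add: field_simps)
    ultimately show ?thesis by simp
  qed (use neg assms in blast)
qed

text \<open>Bernoulli at the ratio (i + 1) / i with exponent \<alpha> + 1, scaled by
  \<open>real i powr (\<alpha> + 1)\<close>. It drives the induction in
  \<open>sum_signal_weights_max_ge\<close>.\<close>

lemma powr_Suc_diff_ge:
  fixes \<alpha> :: real
  assumes "\<alpha> > 0"
  shows "(\<alpha> + 1) * real i powr \<alpha> \<le> real (Suc i) powr (\<alpha> + 1) - real i powr (\<alpha> + 1)"
proof (cases "i = 0")
  case False
  then have i: "real i > 0" by simp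
  have "1 + (\<alpha> + 1) * (real (Suc i) / real i - 1) \<le> (real (Suc i) / real i) powr (\<alpha> + 1)"
    using assms i by (intro one_plus_le_powr) auto
  also have "\<dots> = real (Suc i) powr (\<alpha> + 1) / real i powr (\<alpha> + 1)"
    using i by (simp add: powr_divide)
  finally have "(1 + (\<alpha> + 1) / real i) * real i powr (\<alpha> + 1) \<le> real (Suc i) powr (\<alpha> + 1)"
    using i by (simp add: field_simps)
  moreover have "(1 + (\<alpha> + 1) / real i) * real i powr (\<alpha> + 1)
      = real i powr (\<alpha> + 1) + (\<alpha> + 1) * real i powr \<alpha>"
    using i by (simp add: powr_add field_simps)
  ultimately show ?thesis by linarith
qed auto

text \<open>Bernoulli at the same ratio with the negative exponent -\<alpha>: a discrete substitute
  for integrating x powr -(\<alpha> + 1).\<close>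

lemma powr_minus_Suc_diff_le:
  fixes \<alpha> :: real
  assumes "\<alpha> > 0" "i > 0"
  shows "real i powr (-\<alpha>) - real (Suc i) powr (-\<alpha>) \<le> \<alpha> * real i powr (-(\<alpha> + 1))"
proof -
  have i: "real i > 0" using assms by simp
  have "1 + (-\<alpha>) * (real (Suc i) / real i - 1) \<le> (real (Suc i) / real i) powr (-\<alpha>)"
    using assms i by (intro one_plus_le_powr) auto
  also have "\<dots> = real (Suc i) powr (-\<alpha>) / real i powr (-\<alpha>)"
    using i by (simp add: powr_divide)
  finally have "(1 - \<alpha> / real i) * real i powr (-\<alpha>) \<le> real (Suc i) powr (-\<alpha>)"
    using i by (simp add: field_simps)
  moreover have "(1 - \<alpha> / real i) * real i powr (-\<alpha>)
      = real i powr (-\<alpha>) - \<alpha> * real i powr (-(\<alpha> + 1))"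
    using i powr_add[of "real i" "-\<alpha>" "-1"] by (simp add: powr_minus_divide field_simps)
  ultimately show ?thesis by linarith
qed

lemma sum_powr_minus_ge:
  fixes \<alpha> :: real
  assumes "\<alpha> > 0" "k > 0" "k \<le> n"
  shows "real k powr (-\<alpha>) - real n powr (-\<alpha>) \<le> \<alpha> * (\<Sum>i=k..n. real i powr (-(\<alpha> + 1)))"
proof -
  have "real k powr (-\<alpha>) - real (Suc n) powr (-\<alpha>) = (\<Sum>i=k..n. real i powr (-\<alpha>) - real (Suc i) powr (-\<alpha>))"
    using sum_Suc_diff[of k n "\<lambda>i. - (real i powr (-\<alpha>))"] assms by simp
  also have "\<dots> \<le> (\<Sum>i=k..n. \<alpha> * real i powr (-(\<alpha> + 1)))"
    using assms by (intro sum_mono powr_minus_Suc_diff_le) auto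
  also have "\<dots> = \<alpha> * (\<Sum>i=k..n. real i powr (-(\<alpha> + 1)))"
    by (rule sum_distrib_left[symmetric])
  finally have *: "real k powr (-\<alpha>) - real (Suc n) powr (-\<alpha>) \<le> \<dots>" .
  \<comment> \<open>The telescoping sum ends at n + 1; the end point is moved to n so that only the
    ratio k / n appears later.\<close>
  have "real (Suc n) powr (-\<alpha>) \<le> real n powr (-\<alpha>)"
    using assms by (intro powr_mono2') auto
  with * show ?thesis by linarith
qed

section \<open>Expectation of the effective threshold and its average over the best time\<close>

text \<open>Induction on i starting at k, in place of a stochastic domination argument. At i = k
  every maximum is k, the weights telescope, and both sides agree. Each further step adds a summand
  whose maximum is i + 1, and the required increment is a rearrangement of
  \<open>powr_Suc_diff_ge\<close>.\<close>

lemma sum_signal_weights_max_ge: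
  fixes \<alpha> :: real
  assumes "\<alpha> > 0" "k \<le> i"
  shows "(\<alpha> * real i powr (\<alpha> + 1) + real k powr (\<alpha> + 1)) / (\<alpha> + 1)
    \<le> (\<Sum>s=1..i. (real s powr \<alpha> - (real s - 1) powr \<alpha>) * real (max s k))"
  using assms(2)
proof (induction i rule: dec_induct)
  case base
  have "(\<Sum>s=1..m. real s powr \<alpha> - (real s - 1) powr \<alpha>) = real m powr \<alpha>" for m
    using assms by (induction m) (auto simp: algebra_simps)
  from this[of k] have "(\<Sum>s=1..k. (real s powr \<alpha> - (real s - 1) powr \<alpha>) * real (max s k)) = real k powr \<alpha> * real k"
    by (simp add: max_absorb2 flip: sum_distrib_right)
  moreover have "(\<alpha> * real k powr (\<alpha> + 1) + real k powr (\<alpha> + 1)) / (\<alpha> + 1) = real k powr (\<alpha> + 1)"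
    using assms by (simp add: field_simps)
  moreover have "real k powr (\<alpha> + 1) = real k powr \<alpha> * real k" by (cases "k = 0") (simp_all add: powr_add)
  ultimately show ?case by simp
next
  case (step i)
  let ?a = "real i powr \<alpha>" and ?b = "real (Suc i) powr \<alpha>"
  have a: "real i powr (\<alpha> + 1) = ?a * real i" by (cases "i = 0") (simp_all add: powr_add)
  have b: "real (Suc i) powr (\<alpha> + 1) = ?b * real (Suc i)" by (simp add: powr_add)
  have "(\<alpha> + 1) * ?a \<le> ?b * real (Suc i) - ?a * real i"
    using powr_Suc_diff_ge[OF assms(1), of i] unfolding a b .
  then have "\<alpha> / (\<alpha> + 1) * (real (Suc i) powr (\<alpha> + 1) - real i powr (\<alpha> + 1)) \<le> (?b - ?a) * real (Suc i)"
    using assms unfolding a b by (simp add: field_simps)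
  then have "(\<alpha> * real (Suc i) powr (\<alpha> + 1) + real k powr (\<alpha> + 1)) / (\<alpha> + 1)
      \<le> (\<alpha> * real i powr (\<alpha> + 1) + real k powr (\<alpha> + 1)) / (\<alpha> + 1) + (?b - ?a) * real (Suc i)"
    using assms by (simp add: add_divide_distrib right_diff_distrib diff_divide_distrib)
  then show ?case using step by (simp add: max_absorb1)
qed

lemma expectation_max_signal_ge:
  assumes "\<alpha> > 0" "k \<le> i" "i > 0"
  shows "\<alpha> / (\<alpha> + 1) + (real k / real i) powr (\<alpha> + 1) / (\<alpha> + 1)
    \<le> (\<Sum>s=1..i. pmf (signal_pmf \<alpha> i) s * real (max s k)) / real i"
proof -
  have i: "real i powr (\<alpha> + 1) > 0" using assms by simp
  have "(\<Sum>s=1..i. pmf (signal_pmf \<alpha> i) s * real (max s k)) / real i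
      = (\<Sum>s=1..i. (real s powr \<alpha> - (real s - 1) powr \<alpha>) * real (max s k)) / real i powr (\<alpha> + 1)"
    using assms by (simp add: pmf_signal_pmf sum_divide_distrib powr_add del: of_nat_max)
  also have "\<dots> \<ge> (\<alpha> * real i powr (\<alpha> + 1) + real k powr (\<alpha> + 1)) / (\<alpha> + 1) / real i powr (\<alpha> + 1)"
    using sum_signal_weights_max_ge[OF assms(1,2)] i by (intro divide_right_mono) auto
  moreover have "(\<alpha> * real i powr (\<alpha> + 1) + real k powr (\<alpha> + 1)) / (\<alpha> + 1) / real i powr (\<alpha> + 1)
     = \<alpha> / (\<alpha> + 1) + (real k / real i) powr (\<alpha> + 1) / (\<alpha> + 1)"
    using i assms by (simp add: powr_divide add_divide_distrib)
  ultimately show ?thesis by linarith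
qed

lemma average_threshold_ge:
  assumes "\<alpha> > 0" "k \<le> n" "n > 0"
  shows "threshold_value \<alpha> (real k / real n)
    \<le> (\<Sum>i=max 1 k..n. \<alpha> / (\<alpha> + 1) + (real k / real i) powr (\<alpha> + 1) / (\<alpha> + 1)) / real n"
\<comment> \<open>For k = 0 both sides equal \<alpha> / (\<alpha> + 1). The case is separate because
  negative powers of k occur below.\<close>
proof (cases "k = 0")
  case True
  then show ?thesis using assms by (simp add: threshold_value_def)
next
  case False
  then have k: "real k > 0" "k > 0" "max 1 k = k" by auto
  define c where "c = real k / real n"
  have cp: "c > 0" using k assms by (simp add: c_def)
  have "real k powr (\<alpha> + 1) * (real k powr (-\<alpha>) - real n powr (-\<alpha>)) / \<alpha>
      \<le> real k powr (\<alpha> + 1) * (\<alpha> * (\<Sum>i=k..n. real i powr (-(\<alpha> + 1)))) / \<alpha>"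
    using sum_powr_minus_ge[OF assms(1) k(2) assms(2)] assms
    by (intro divide_right_mono mult_left_mono) auto
  also have "\<dots> = (\<Sum>i=k..n. (real k / real i) powr (\<alpha> + 1))"
    unfolding powr_divide powr_minus_divide using assms
    by (simp add: sum_distrib_left sum_divide_distrib)
  also have "real k powr (\<alpha> + 1) * (real k powr (-\<alpha>) - real n powr (-\<alpha>)) / \<alpha>
      = real n * (c - c powr (\<alpha> + 1)) / \<alpha>"
    using k assms by (simp add: c_def powr_add powr_minus_divide powr_divide field_simps)
  finally have S: "real n * (c - c powr (\<alpha> + 1)) / \<alpha> \<le> (\<Sum>i=k..n. (real k / real i) powr (\<alpha> + 1))" .
  have "threshold_value \<alpha> c = (1 - c) * (\<alpha> / (\<alpha> + 1)) + (c - c powr (\<alpha> + 1)) / \<alpha> / (\<alpha> + 1)"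
    using assms unfolding threshold_value_def by (simp add: divide_simps) (simp add: algebra_simps)
  also have "\<dots> = ((real n - real k) * (\<alpha> / (\<alpha> + 1)) + real n * (c - c powr (\<alpha> + 1)) / \<alpha> / (\<alpha> + 1)) / real n"
  proof -
    have "(1 - c) * A + D = ((real n - real k) * A + real n * D) / real n" for A D
      using assms by (simp add: c_def field_simps)
    from this[of "\<alpha> / (\<alpha> + 1)" "(c - c powr (\<alpha> + 1)) / \<alpha> / (\<alpha> + 1)"] show ?thesis by simp
  qed
  \<comment> \<open>The index range has n - k + 1 elements; the extra constant term only
    helps.\<close>
  also have "\<dots> \<le> ((real n - real k + 1) * (\<alpha> / (\<alpha> + 1)) + (\<Sum>i=k..n. (real k / real i) powr (\<alpha> + 1)) / (\<alpha> + 1)) / real n"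
    using S assms by (intro divide_right_mono add_mono mult_right_mono) auto
  also have "\<dots> = (\<Sum>i=k..n. \<alpha> / (\<alpha> + 1) + (real k / real i) powr (\<alpha> + 1) / (\<alpha> + 1)) / real n"
    using assms by (simp add: sum.distrib sum_divide_distrib of_nat_diff Suc_diff_le)
  finally show ?thesis unfolding k c_def .
qed

section \<open>Bounds and monotonicity of the threshold value\<close>

lemma exp_1_ge: "exp 1 \<ge> (5 / 2 :: real)"
  using exp_lower_Taylor_quadratic[of 1] by simp

text \<open>Clearing denominators reduces the claim to exp (-\<gamma>) \<le> 1 - \<gamma> + (e - 2)
  * \<gamma>^2. Since e - 2 \<ge> 1/2, it suffices to use the quadratic Taylor polynomial of exp
  (-\<gamma>).\<close>

lemma inverse_exp_1_le_threshold_value: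
  assumes "\<gamma> > 0"
  shows "1 / exp 1 \<le> threshold_value \<gamma> (1 / exp 1)"
proof -
  \<comment> \<open>The Taylor polynomials of exp (-\<gamma>) and exp \<gamma> have a product of at
    least 1, and the second is at most exp \<gamma>; hence the first is at least exp
    (-\<gamma>).\<close>
  have "(1 - \<gamma> + \<gamma>\<^sup>2 / 2) * (1 + \<gamma> + \<gamma>\<^sup>2 / 2) = 1 + (\<gamma>\<^sup>2)\<^sup>2 / 4"
    by (simp add: power2_eq_square algebra_simps)
  then have "1 \<le> (1 - \<gamma> + \<gamma>\<^sup>2 / 2) * (1 + \<gamma> + \<gamma>\<^sup>2 / 2)" by simp
  also have "1 - \<gamma> + \<gamma>\<^sup>2 / 2 \<ge> 0"
    using sum_squares_ge_zero[of "\<gamma> - 1" 1] by (simp add: power2_eq_square algebra_simps)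
  then have "(1 - \<gamma> + \<gamma>\<^sup>2 / 2) * (1 + \<gamma> + \<gamma>\<^sup>2 / 2) \<le> (1 - \<gamma> + \<gamma>\<^sup>2 / 2) * exp \<gamma>"
    using assms by (intro mult_left_mono exp_lower_Taylor_quadratic) auto
  finally have "exp (-\<gamma>) \<le> 1 - \<gamma> + \<gamma>\<^sup>2 / 2"
    by (simp add: exp_minus divide_simps)
  also have "\<dots> \<le> 1 - \<gamma> + (exp 1 - 2) * \<gamma>\<^sup>2"
    using exp_1_ge mult_right_mono[of "1/2" "exp 1 - 2" "\<gamma>\<^sup>2"] by simp
  finally have *: "exp (-\<gamma>) \<le> 1 - \<gamma> + (exp 1 - 2) * \<gamma>\<^sup>2" .
  have p: "(1 / exp 1) powr (\<gamma> + 1) = exp (-\<gamma>) / exp (1::real)"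
    by (simp add: powr_def ln_div exp_diff exp_minus exp_add field_simps)
  have "threshold_value \<gamma> (1 / exp 1) - 1 / exp 1
     = (1 - \<gamma> + (exp 1 - 2) * \<gamma>\<^sup>2 - exp (-\<gamma>)) / (\<gamma> * (\<gamma> + 1) * exp 1)"
    unfolding threshold_value_def p using assms
    by (simp add: divide_simps) (simp add: power2_eq_square algebra_simps)
  also have "\<dots> \<ge> 0" using * assms by (intro divide_nonneg_nonneg) auto
  finally show ?thesis by linarith
qed

text \<open>The derivative is put in a form where \<alpha> enters only through (1 - z powr \<alpha>)
  / \<alpha>, whose monotonicity in \<alpha> comes next.\<close>

lemma threshold_value_has_derivative:
  assumes "\<alpha> > 0" "z > 0"
  shows "(threshold_value \<alpha> has_real_derivative (1 - z powr \<alpha>) / \<alpha> - 1) (at z)"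
proof -
  have "((\<lambda>x. x powr (\<alpha> + 1)) has_real_derivative (\<alpha> + 1) * z powr \<alpha>) (at z)"
    using has_real_derivative_powr[OF assms(2), of "\<alpha> + 1"] by simp
  then have "(threshold_value \<alpha> has_real_derivative
      0 + (1 - \<alpha>) / \<alpha> * 1 - (\<alpha> + 1) * z powr \<alpha> / (\<alpha> * (\<alpha> + 1))) (at z)"
    unfolding threshold_value_def
    by (intro DERIV_add DERIV_diff DERIV_const DERIV_cmult DERIV_ident DERIV_cdivide)
  moreover have "0 + (1 - \<alpha>) / \<alpha> * 1 - (\<alpha> + 1) * z powr \<alpha> / (\<alpha> * (\<alpha> + 1)) = (1 - z powr \<alpha>) / \<alpha> - 1"
    using assms by (simp add: divide_simps)
  ultimately show ?thesis by simp
qed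

text \<open>Bernoulli at z powr \<gamma> with exponent \<alpha> / \<gamma> \<ge> 1.\<close>

lemma one_minus_powr_div_antimono:
  fixes \<gamma> \<alpha> z :: real
  assumes "0 < \<gamma>" "\<gamma> \<le> \<alpha>" "0 < z"
  shows "(1 - z powr \<alpha>) / \<alpha> \<le> (1 - z powr \<gamma>) / \<gamma>"
proof -
  have "1 + \<alpha> / \<gamma> * (z powr \<gamma> - 1) \<le> (z powr \<gamma>) powr (\<alpha> / \<gamma>)"
    using assms by (intro one_plus_le_powr) auto
  then have "1 + \<alpha> / \<gamma> * (z powr \<gamma> - 1) \<le> z powr \<alpha>"
    using assms by (simp add: powr_powr)
  then show ?thesis using assms by (simp add: field_simps)
qed

lemma threshold_value_mono:
  assumes "0 < \<gamma>" "\<gamma> \<le> \<alpha>" "0 \<le> b" "b \<le> 1"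
  shows "threshold_value \<gamma> b \<le> threshold_value \<alpha> b"
\<comment> \<open>The derivative formula covers positive arguments only; at 0 the claim is
  monotonicity of a / (a + 1).\<close>
proof (cases "b = 0")
  case True
  then show ?thesis using assms by (simp add: threshold_value_def field_simps)
next
  case False
  have "threshold_value \<alpha> 1 - threshold_value \<gamma> 1 \<le> threshold_value \<alpha> b - threshold_value \<gamma> b"
  proof (rule DERIV_nonpos_imp_nonincreasing[OF assms(4)])
    fix x assume "b \<le> x"
    then have x: "x > 0" using assms False by linarith
    show "\<exists>y. ((\<lambda>x. threshold_value \<alpha> x - threshold_value \<gamma> x) has_real_derivative y) (at x) \<and> y \<le> 0"
    proof (intro exI conjI)
      show "((\<lambda>x. threshold_value \<alpha> x - threshold_value \<gamma> x) has_real_derivative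
          ((1 - x powr \<alpha>) / \<alpha> - 1) - ((1 - x powr \<gamma>) / \<gamma> - 1)) (at x)"
        using assms x by (intro DERIV_diff threshold_value_has_derivative) auto
      show "((1 - x powr \<alpha>) / \<alpha> - 1) - ((1 - x powr \<gamma>) / \<gamma> - 1) \<le> 0"
        using one_minus_powr_div_antimono[OF assms(1,2) x] by linarith
    qed
  qed
  moreover have "threshold_value a 1 = 0" if "a > 0" for a
    using that unfolding threshold_value_def by (simp add: divide_simps) (simp add: algebra_simps)
  ultimately show ?thesis using assms by simp
qed

lemma beta_star_bounds:
  assumes "\<gamma> > 0"
  shows "0 \<le> beta_star \<gamma>" "beta_star \<gamma> \<le> 1"
  using assms by (auto simp: beta_star_eq intro: powr_le1)

text \<open>The two case distinctions differ at \<gamma> = 1, where they agree because 0 powr r =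
  0.\<close>

lemma guarantee_eq_threshold_value:
  assumes "\<gamma> > 0"
  shows "guarantee \<alpha> \<gamma> = threshold_value \<alpha> (beta_star \<gamma>)"
  using assms by (auto simp: guarantee_def beta_star_eq threshold_value_def powr_powr)

lemma OPT_eq_threshold_value:
  assumes "\<gamma> > 0"
  shows "OPT \<gamma> = threshold_value \<gamma> (beta_star \<gamma>)"
proof (cases "\<gamma> < 1")
  case True
  define B where "B = (1 - \<gamma>) powr (1 / \<gamma>)"
  \<comment> \<open>B is the critical point of the threshold value; this equation makes its power
    term linear in B.\<close>
  have "B powr \<gamma> = 1 - \<gamma>" using assms True by (simp add: B_def powr_powr)
  then have B1: "B powr (\<gamma> + 1) = (1 - \<gamma>) * B" by (simp add: powr_add B_def)
  have B2: "(1 - \<gamma>) powr (1 + 1 / \<gamma>) = (1 - \<gamma>) * B"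
    unfolding powr_add B_def using True by simp
  have "OPT \<gamma> = (\<gamma> + (1 - \<gamma>) * B) / (\<gamma> + 1)"
    using True by (simp add: OPT_def B2)
  also have "\<dots> = threshold_value \<gamma> B"
    unfolding threshold_value_def B1 using assms by (simp add: divide_simps) (simp add: algebra_simps)
  finally show ?thesis using True assms by (simp add: beta_star_eq B_def)
qed (use assms in \<open>simp add: OPT_def beta_star_eq threshold_value_def\<close>)

lemma OPT_ge_inverse_exp_1:
  assumes "\<gamma> > 0"
  shows "1 / exp 1 \<le> OPT \<gamma>"
\<comment> \<open>\<open>threshold_value_less\<close> is strict, so equality with the maximizer is
  treated apart.\<close>
proof (cases "1 / exp 1 = beta_star \<gamma>")
  case True
  then show ?thesis
    using inverse_exp_1_le_threshold_value[OF assms] OPT_eq_threshold_value[OF assms] by simp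
next
  case False
  have "1 / exp 1 \<le> threshold_value \<gamma> (1 / exp 1)"
    by (rule inverse_exp_1_le_threshold_value[OF assms])
  also have "\<dots> \<le> threshold_value \<gamma> (beta_star \<gamma>)"
    using threshold_value_less[OF assms, of "1 / exp 1"] False
    unfolding beta_star_eq[OF assms] by simp
  finally show ?thesis using OPT_eq_threshold_value[OF assms] by simp
qed

lemma OPT_le_guarantee:
  assumes "0 < \<gamma>" "\<gamma> \<le> \<alpha>"
  shows "OPT \<gamma> \<le> guarantee \<alpha> \<gamma>"
  using assms by (simp add: OPT_eq_threshold_value guarantee_eq_threshold_value
      threshold_value_mono beta_star_bounds)

subsection \<open>Arrival orders\<close>

text \<open>Turns symmetry into uniformity: equal fibres split P into \<open>card X\<close> parts of
  the same size.\<close>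

lemma card_fibre_eq:
  assumes "finite P" "finite X" "f ` P \<subseteq> X" "x \<in> X"
    and "\<And>y. y \<in> X \<Longrightarrow> card {p \<in> P. f p = y} = card {p \<in> P. f p = x}"
  shows "card X * card {p \<in> P. f p = x} = card P"
proof -
  have "card P = (\<Sum>y\<in>X. card {p \<in> P. f p = y})"
    using sum.group[OF assms(1-3), of "\<lambda>_. 1::nat"] by simp
  also have "\<dots> = card X * card {p \<in> P. f p = x}"
    using assms(5) by simp
  finally show ?thesis by simp
qed

text \<open>A strict maximum is unique, so the choice hidden in \<open>arg_max_on\<close> has only
  one candidate.\<close>

lemma best_time_eqI:
  assumes "t \<in> {1..m}" "\<And>u. u \<in> {1..m} \<Longrightarrow> u \<noteq> t \<Longrightarrow> v (\<sigma> u) < v (\<sigma> t)"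
  shows "best_time m v \<sigma> = t"
proof -
  have "is_arg_max (\<lambda>u. v (\<sigma> u)) (\<lambda>u. u \<in> {1..m}) = (\<lambda>u. u = t)"
    using assms by (fastforce simp: is_arg_max_def)
  then show ?thesis
    unfolding best_time_def arg_max_on_def arg_max_def by simp
qed

lemma best_time_greatest:
  assumes "inj_on (v \<circ> \<sigma>) {1..m}" "m \<ge> 1"
  shows "best_time m v \<sigma> \<in> {1..m}"
    and "\<And>u. u \<in> {1..m} \<Longrightarrow> u \<noteq> best_time m v \<sigma> \<Longrightarrow> v (\<sigma> u) < v (\<sigma> (best_time m v \<sigma>))"
proof -
  have "Max ((v \<circ> \<sigma>) ` {1..m}) \<in> (v \<circ> \<sigma>) ` {1..m}"
    using assms by (intro Max_in) auto
  then obtain t where t: "t \<in> {1..m}" "(v \<circ> \<sigma>) t = Max ((v \<circ> \<sigma>) ` {1..m})" by auto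
  have less: "v (\<sigma> u) < v (\<sigma> t)" if "u \<in> {1..m}" "u \<noteq> t" for u
  proof -
    have "v (\<sigma> u) \<le> v (\<sigma> t)" using t that by (auto intro: Max_ge)
    moreover have "v (\<sigma> u) \<noteq> v (\<sigma> t)" using inj_onD[OF assms(1), of u t] t that by auto
    ultimately show ?thesis by simp
  qed
  have "best_time m v \<sigma> = t" using t(1) less by (rule best_time_eqI)
  then show "best_time m v \<sigma> \<in> {1..m}"
    "\<And>u. u \<in> {1..m} \<Longrightarrow> u \<noteq> best_time m v \<sigma> \<Longrightarrow> v (\<sigma> u) < v (\<sigma> (best_time m v \<sigma>))"
    using t(1) less by auto
qed

text \<open>Swapping two of the first m times permutes those times, and a transposition is its own
  inverse, so the strict maximum moves along with the swap.\<close>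

lemma best_time_comp_transpose:
  assumes "inj_on (v \<circ> \<sigma>) {1..m}" "a \<in> {1..m}" "b \<in> {1..m}"
  shows "best_time m v (\<sigma> \<circ> Transposition.transpose a b) = Transposition.transpose a b (best_time m v \<sigma>)"
proof (rule best_time_eqI)
  have m: "m \<ge> 1" using assms by simp
  note bt = best_time_greatest[OF assms(1) m]
  have perm: "Transposition.transpose a b u \<in> {1..m} \<longleftrightarrow> u \<in> {1..m}" for u
    using permutes_in_image[OF permutes_swap_id[OF assms(2,3)]] .
  show "Transposition.transpose a b (best_time m v \<sigma>) \<in> {1..m}" using bt(1) perm by blast
  fix u assume u: "u \<in> {1..m}" "u \<noteq> Transposition.transpose a b (best_time m v \<sigma>)"
  have "Transposition.transpose a b u \<noteq> best_time m v \<sigma>"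
    using u(2) by (metis transpose_involutory)
  then show "v ((\<sigma> \<circ> Transposition.transpose a b) u) < v ((\<sigma> \<circ> Transposition.transpose a b) (Transposition.transpose a b (best_time m v \<sigma>)))"
    using bt(2) perm u(1) by simp
qed

lemma inj_on_values_of_order:
  fixes m n :: nat and v :: "nat \<Rightarrow> real"
  assumes "inj_on v {1..n}" "\<sigma> permutes {1..n}" "m \<le> n"
  shows "inj_on (v \<circ> \<sigma>) {1..m}"
proof (rule comp_inj_on)
  show "inj_on \<sigma> {1..m}" using permutes_inj_on[OF assms(2)] .
  have "\<sigma> ` {1..m} \<subseteq> \<sigma> ` {1..n}" using assms(3) by (intro image_mono) auto
  also have "\<dots> = {1..n}" using permutes_image[OF assms(2)] .
  finally show "inj_on v (\<sigma> ` {1..m})" using assms(1) inj_on_subset by blast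
qed

text \<open>Swapping two times \<open>a\<close> and \<open>b\<close> is a bijection between the orders counted on the two sides.\<close>

lemma card_comp_transpose_eq:
  fixes a b n :: nat
  assumes "a \<in> {1..n}" "b \<in> {1..n}"
    and "\<And>\<sigma>. \<sigma> permutes {1..n} \<Longrightarrow> Q (\<sigma> \<circ> Transposition.transpose a b) \<longleftrightarrow> R \<sigma>"
  shows "card {\<sigma>. \<sigma> permutes {1..n} \<and> Q \<sigma>} = card {\<sigma>. \<sigma> permutes {1..n} \<and> R \<sigma>}"
proof (rule bij_betw_same_card[of "\<lambda>\<sigma>. \<sigma> \<circ> Transposition.transpose a b"])
  have p: "\<sigma> \<circ> Transposition.transpose a b permutes {1..n}" if "\<sigma> permutes {1..n}" for \<sigma>
    using permutes_compose[OF permutes_swap_id[OF assms(1,2)] that] .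
  have inv: "\<sigma> \<circ> Transposition.transpose a b \<circ> Transposition.transpose a b = \<sigma>" for \<sigma> :: "nat \<Rightarrow> nat"
    by (simp add: comp_assoc)
  show "bij_betw (\<lambda>\<sigma>. \<sigma> \<circ> Transposition.transpose a b) {\<sigma>. \<sigma> permutes {1..n} \<and> Q \<sigma>} {\<sigma>. \<sigma> permutes {1..n} \<and> R \<sigma>}"
    by (rule bij_betw_byWitness[where f' = "\<lambda>\<sigma>. \<sigma> \<circ> Transposition.transpose a b"])
      (use p inv assms(3) in \<open>auto simp flip: assms(3)\<close>)
qed

lemma card_best_time:
  assumes "inj_on v {1..n}" "i \<in> {1..n}"
  shows "n * card {\<sigma>. \<sigma> permutes {1..n} \<and> best_time n v \<sigma> = i} = fact n"
proof -
  let ?P = "{\<sigma>. \<sigma> permutes {1..n}}"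
  have P: "finite ?P" "card ?P = fact n"
    using card_permutations[of "{1..n}" n] by (auto simp: finite_permutations)
  have n: "n \<ge> 1" using assms by simp
  \<comment> \<open>Swapping times y and i exchanges these two fibres.\<close>
  have "card {\<sigma> \<in> ?P. best_time n v \<sigma> = y} = card {\<sigma> \<in> ?P. best_time n v \<sigma> = i}"
    if "y \<in> {1..n}" for y
    unfolding mem_Collect_eq
  proof (rule card_comp_transpose_eq[OF that assms(2)])
    fix \<sigma> assume "\<sigma> permutes {1..n}"
    then show "best_time n v (\<sigma> \<circ> Transposition.transpose y i) = y \<longleftrightarrow> best_time n v \<sigma> = i"
      using best_time_comp_transpose[OF inj_on_values_of_order[OF assms(1) _ order_refl] that assms(2)]
      by (auto simp: Transposition.transpose_def)
  qed
  moreover have "best_time n v ` ?P \<subseteq> {1..n}"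
    using best_time_greatest(1)[OF inj_on_values_of_order[OF assms(1) _ order_refl] n] by blast
  ultimately have "card {1..n} * card {\<sigma> \<in> ?P. best_time n v \<sigma> = i} = card ?P"
    by (intro card_fibre_eq P assms(2)) auto
  then show ?thesis using P by simp
qed

text \<open>Given the best time i, the position of the best earlier item is uniform: swapping two
  times before i leaves i in place but exchanges the candidate positions.\<close>

lemma card_best_time_best_time_before:
  assumes "inj_on v {1..n}" "i \<in> {1..n}" "j \<in> {1..i - 1}"
  shows "n * (i - 1) * card {\<sigma>. \<sigma> permutes {1..n} \<and> best_time n v \<sigma> = i \<and> best_time (i - 1) v \<sigma> = j} = fact n"
proof -
  let ?P = "{\<sigma>. \<sigma> permutes {1..n} \<and> best_time n v \<sigma> = i}"
  have P: "finite ?P" by (rule finite_subset[OF _ finite_permutations[of "{1..n}"]]) auto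
  have i: "i - 1 \<ge> 1" "i - 1 \<le> n" using assms by auto
  have "card {\<sigma> \<in> ?P. best_time (i - 1) v \<sigma> = y} = card {\<sigma> \<in> ?P. best_time (i - 1) v \<sigma> = j}"
    if y: "y \<in> {1..i - 1}" for y
    unfolding mem_Collect_eq conj_assoc
  proof (rule card_comp_transpose_eq)
    show yj: "y \<in> {1..n}" "j \<in> {1..n}" using that assms by auto
    fix \<sigma> assume \<sigma>: "\<sigma> permutes {1..n}"
    have "best_time n v (\<sigma> \<circ> Transposition.transpose y j) = i \<longleftrightarrow> best_time n v \<sigma> = i"
    proof -
      have "best_time n v (\<sigma> \<circ> Transposition.transpose y j) = Transposition.transpose y j (best_time n v \<sigma>)"
        by (rule best_time_comp_transpose[OF inj_on_values_of_order[OF assms(1) \<sigma> order_refl] yj])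
      moreover have "Transposition.transpose y j i = i" using y assms by (intro transpose_apply_other) auto
      ultimately show ?thesis by (auto simp: Transposition.transpose_def split: if_splits)
    qed
    moreover have "best_time (i - 1) v (\<sigma> \<circ> Transposition.transpose y j) = y \<longleftrightarrow> best_time (i - 1) v \<sigma> = j"
      using best_time_comp_transpose[OF inj_on_values_of_order[OF assms(1) \<sigma> i(2)] y assms(3)]
      by (auto simp: Transposition.transpose_def)
    ultimately show "best_time n v (\<sigma> \<circ> Transposition.transpose y j) = i \<and> best_time (i - 1) v (\<sigma> \<circ> Transposition.transpose y j) = y
        \<longleftrightarrow> best_time n v \<sigma> = i \<and> best_time (i - 1) v \<sigma> = j" by simp
  qed
  moreover have "best_time (i - 1) v ` ?P \<subseteq> {1..i - 1}"
    using best_time_greatest(1)[OF inj_on_values_of_order[OF assms(1) _ i(2)] i(1)] by blast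
  ultimately have "card {1..i - 1} * card {\<sigma> \<in> ?P. best_time (i - 1) v \<sigma> = j} = card ?P"
    by (intro card_fibre_eq P assms(3)) auto
  then have "(i - 1) * card {\<sigma> \<in> ?P. best_time (i - 1) v \<sigma> = j} = card ?P" by simp
  then show ?thesis using card_best_time[OF assms(1,2)] by (simp add: mult.assoc conj_assoc)
qed

lemma card_best_time_before_less:
  assumes "inj_on v {1..n}" "i \<in> {1..n}" "1 \<le> m" "m \<le> i"
  shows "real (card {\<sigma>. \<sigma> permutes {1..n} \<and> best_time n v \<sigma> = i \<and> best_time (i - 1) v \<sigma> \<in> {1..<m}})
    \<ge> (real m - 1) / real i * fact n / real n"
\<comment> \<open>For m = 1 the bound is 0; otherwise i > 1, so division by i - 1 is sound.\<close>
proof (cases "m = 1")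
  case False
  let ?F = "\<lambda>j. {\<sigma>. \<sigma> permutes {1..n} \<and> best_time n v \<sigma> = i \<and> best_time (i - 1) v \<sigma> = j}"
  have i: "i > 1" "n > 0" using False assms by auto
  have F: "real (card (?F j)) = fact n / (real n * real (i - 1))" if "j \<in> {1..<m}" for j
  proof -
    have "n * (i - 1) * card (?F j) = fact n"
      using that assms by (intro card_best_time_best_time_before) auto
    then have "real n * real (i - 1) * real (card (?F j)) = fact n"
      by (simp flip: of_nat_mult)
    then show ?thesis using i by (simp add: field_simps)
  qed
  \<comment> \<open>The exact fraction has denominator i - 1; it is weakened to i to match
    \<open>expectation_max_signal_ge\<close>.\<close>
  have "(real m - 1) / real i * fact n / real n \<le> (real m - 1) / real (i - 1) * fact n / real n"
    using assms i by (intro divide_right_mono mult_right_mono divide_left_mono) auto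
  also have "\<dots> = (\<Sum>j\<in>{1..<m}. real (card (?F j)))"
    using F assms by (simp add: of_nat_diff)
  also have "\<dots> = real (card (\<Union>j\<in>{1..<m}. ?F j))"
  proof (subst card_UN_disjoint)
    show "\<forall>j\<in>{1..<m}. finite (?F j)"
      by (simp add: finite_permutations)
  qed auto
  also have "(\<Union>j\<in>{1..<m}. ?F j) = {\<sigma>. \<sigma> permutes {1..n} \<and> best_time n v \<sigma> = i \<and> best_time (i - 1) v \<sigma> \<in> {1..<m}}"
    by auto
  finally show ?thesis .
qed simp

section \<open>From the policy to a lower bound on its success probability\<close>

text \<open>If the best item before time i arrived before the effective threshold, it beats every
  item between the threshold and i, so the first record accepted is at i.\<close>

lemma stops_at_best_time:
  assumes "inj_on v {1..n}" "\<sigma> permutes {1..n}" "n \<ge> 1" "1 \<le> s"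
    and "max s k \<le> best_time n v \<sigma>" "best_time (best_time n v \<sigma> - 1) v \<sigma> \<in> {1..<max s k}"
  shows "stops_at (signal_threshold_policy k) n v \<sigma> s (best_time n v \<sigma>)"
proof -
  define i where "i = best_time n v \<sigma>"
  define j where "j = best_time (i - 1) v \<sigma>"
  note bt = best_time_greatest[OF inj_on_values_of_order[OF assms(1,2) order_refl] assms(3), folded i_def]
  have j: "j \<in> {1..<max s k}" "max s k \<le> i" using assms by (simp_all add: i_def j_def)
  have i: "i - 1 \<ge> 1" "i - 1 \<le> n" using j bt(1) by auto
  note bj = best_time_greatest(2)[OF inj_on_values_of_order[OF assms(1,2) i(2)] i(1), folded j_def]
  have "is_record v \<sigma> i" using bt by (auto simp: is_record_def)
  moreover have "\<not> is_record v \<sigma> u" if "u \<in> {1..<i}" "max s k \<le> u" for u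
  proof -
    have "v (\<sigma> u) < v (\<sigma> j)" using that j by (intro bj) auto
    moreover have "j \<in> {1..<u}" using that j by auto
    ultimately show ?thesis unfolding is_record_def by (meson less_asym)
  qed
  ultimately show ?thesis
    using bt(1) j(2) unfolding stops_at_signal_threshold_policy[OF assms(4)] i_def[symmetric] by blast
qed

lemma success_prob_eq_sum:
  "success_prob \<alpha> n v P = (\<Sum>\<sigma> | \<sigma> permutes {1..n}.
     measure_pmf.prob (signal_pmf \<alpha> (best_time n v \<sigma>)) {s. stops_at P n v \<sigma> s (best_time n v \<sigma>)}) / fact n"
proof -
  let ?P = "{\<sigma>. \<sigma> permutes {1..n}}"
  let ?f = "\<lambda>\<sigma>. measure_pmf.prob (signal_pmf \<alpha> (best_time n v \<sigma>)) {s. stops_at P n v \<sigma> s (best_time n v \<sigma>)}"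
  have P: "finite ?P" "?P \<noteq> {}" "card ?P = fact n"
    using card_permutations[of "{1..n}" n] permutes_id[of "{1..n}"] by (force simp: finite_permutations)+
  have "success_prob \<alpha> n v P = measure_pmf.expectation (pmf_of_set ?P) ?f"
    unfolding success_prob_def instance_pmf_def measure_pmf_bind
    by (subst measure_pmf.measure_bind[where N = "count_space UNIV"])
      (auto simp: vimage_def measurable_def measure_pmf_in_subprob_algebra intro!: Bochner_Integration.integral_cong)
  also have "\<dots> = sum ?f ?P / fact n"
    using P by (subst integral_pmf_of_set) auto
  finally show ?thesis .
qed

text \<open>After scaling by n!, probabilities become counts of orders. Exchanging the sums over
  orders and signals and grouping the orders by best time gives a sum over all orders, bounded
  termwise by \<open>stops_at_best_time\<close>.\<close>

lemma success_prob_ge_sum: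
  assumes "inj_on v {1..n}" "n \<ge> 1"
  shows "success_prob \<alpha> n v (signal_threshold_policy k)
    \<ge> (\<Sum>i=max 1 k..n. (\<Sum>s=1..i. pmf (signal_pmf \<alpha> i) s * ((real (max s k) - 1) / real i))) / real n"
proof -
  let ?P = "{\<sigma>. \<sigma> permutes {1..n}}"
  let ?p = "\<lambda>i. pmf (signal_pmf \<alpha> i)"
  \<comment> \<open>\<open>G\<close> is the sufficient condition of
    \<open>stops_at_best_time\<close>, and \<open>h\<close> is its probability over the signal for a
    fixed order.\<close>
  define G where "G \<sigma> i s \<longleftrightarrow> max s k \<le> i \<and> best_time (i - 1) v \<sigma> \<in> {1..<max s k}" for \<sigma> i s
  define h where "h \<sigma> i = (\<Sum>s=1..i. ?p i s * of_bool (G \<sigma> i s))" for \<sigma> i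
  have fin: "finite ?P" by (simp add: finite_permutations)
  have h0: "h \<sigma> i \<ge> 0" for \<sigma> i unfolding h_def by (intro sum_nonneg mult_nonneg_nonneg) auto
  have "(\<Sum>i=max 1 k..n. (\<Sum>s=1..i. ?p i s * ((real (max s k) - 1) / real i))) / real n * fact n
     = (\<Sum>i=max 1 k..n. \<Sum>s=1..i. ?p i s * ((real (max s k) - 1) / real i * fact n / real n))"
    by (simp add: sum_divide_distrib sum_distrib_right sum_distrib_left mult_ac)
  also have "\<dots> \<le> (\<Sum>i=max 1 k..n. \<Sum>s=1..i. ?p i s *
      real (card {\<sigma>. \<sigma> permutes {1..n} \<and> best_time n v \<sigma> = i \<and> best_time (i - 1) v \<sigma> \<in> {1..<max s k}}))"
    using assms by (intro sum_mono mult_left_mono card_best_time_before_less) auto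
  also have "\<dots> = (\<Sum>i=max 1 k..n. \<Sum>s=1..i. ?p i s * (\<Sum>\<sigma> | \<sigma> \<in> ?P \<and> best_time n v \<sigma> = i. of_bool (G \<sigma> i s)))"
  proof (intro sum.cong refl arg_cong2[where f = "(*)"])
    fix i s assume "i \<in> {max 1 k..n}" "s \<in> {1..i}"
    \<comment> \<open>In this index range the first conjunct of \<open>G\<close> holds
      automatically.\<close>
    then have "max s k \<le> i" by auto
    then have eq: "{\<sigma>. \<sigma> permutes {1..n} \<and> best_time n v \<sigma> = i \<and> best_time (i - 1) v \<sigma> \<in> {1..<max s k}}
        = {\<sigma>. \<sigma> \<in> ?P \<and> best_time n v \<sigma> = i} \<inter> {\<sigma>. G \<sigma> i s}"
      by (auto simp: G_def)
    have "finite {\<sigma>. \<sigma> \<in> ?P \<and> best_time n v \<sigma> = i}" using fin by simp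
    then
    show "real (card {\<sigma>. \<sigma> permutes {1..n} \<and> best_time n v \<sigma> = i \<and> best_time (i - 1) v \<sigma> \<in> {1..<max s k}})
        = (\<Sum>\<sigma> | \<sigma> \<in> ?P \<and> best_time n v \<sigma> = i. of_bool (G \<sigma> i s))"
      unfolding eq by (subst sum_of_bool_eq) auto
  qed
  also have "\<dots> = (\<Sum>i=max 1 k..n. \<Sum>\<sigma> | \<sigma> \<in> ?P \<and> best_time n v \<sigma> = i. h \<sigma> (best_time n v \<sigma>))"
  proof (intro sum.cong refl)
    fix i
    let ?B = "{\<sigma>. \<sigma> \<in> ?P \<and> best_time n v \<sigma> = i}"
    have "(\<Sum>s=1..i. ?p i s * (\<Sum>\<sigma>\<in>?B. of_bool (G \<sigma> i s))) = (\<Sum>\<sigma>\<in>?B. h \<sigma> i)"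
      unfolding h_def sum_distrib_left by (rule sum.swap)
    also have "\<dots> = (\<Sum>\<sigma>\<in>?B. h \<sigma> (best_time n v \<sigma>))" by (intro sum.cong) simp_all
    finally show "(\<Sum>s=1..i. ?p i s * (\<Sum>\<sigma>\<in>?B. of_bool (G \<sigma> i s))) = \<dots>" .
  qed
  \<comment> \<open>Best times before k are added back so that the groups exhaust all orders; their
    terms are nonnegative.\<close>
  also have "\<dots> \<le> (\<Sum>i=1..n. \<Sum>\<sigma> | \<sigma> \<in> ?P \<and> best_time n v \<sigma> = i. h \<sigma> (best_time n v \<sigma>))"
    by (intro sum_mono2) (auto intro!: sum_nonneg h0)
  also have "\<dots> = (\<Sum>\<sigma>\<in>?P. h \<sigma> (best_time n v \<sigma>))"
    using best_time_greatest(1)[OF inj_on_values_of_order[OF assms(1) _ order_refl] assms(2)]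
    by (intro sum.group fin) auto
  also have "\<dots> \<le> (\<Sum>\<sigma>\<in>?P. measure_pmf.prob (signal_pmf \<alpha> (best_time n v \<sigma>))
      {s. stops_at (signal_threshold_policy k) n v \<sigma> s (best_time n v \<sigma>)})"
  proof (rule sum_mono)
    fix \<sigma> assume \<sigma>: "\<sigma> \<in> ?P"
    let ?i = "best_time n v \<sigma>"
    let ?A = "{s \<in> {1..?i}. G \<sigma> ?i s}"
    have "h \<sigma> ?i = sum (?p ?i) ?A"
      unfolding h_def sum.inter_filter[OF finite_atLeastAtMost] by (intro sum.cong) auto
    also have "\<dots> = measure_pmf.prob (signal_pmf \<alpha> ?i) ?A"
      by (rule measure_measure_pmf_finite[symmetric]) simp
    also have "\<dots> \<le> measure_pmf.prob (signal_pmf \<alpha> ?i) {s. stops_at (signal_threshold_policy k) n v \<sigma> s ?i}"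
      using \<sigma> by (intro measure_pmf.finite_measure_mono)
        (auto simp: G_def intro!: stops_at_best_time[OF assms(1) _ assms(2)])
    finally show "h \<sigma> ?i \<le> \<dots>" .
  qed
  finally show ?thesis
    unfolding success_prob_eq_sum by (subst pos_le_divide_eq) auto
qed

subsection \<open>Asymptotics\<close>

text \<open>The -1 in (max S k - 1) / i costs at most 1 / i for each i, because the signal weights
  sum to at most 1. Averaged over i, this is the error \<open>harm n / real n\<close>.\<close>

lemma success_prob_ge_threshold_value:
  assumes "\<alpha> > 0" "inj_on v {1..n}" "n \<ge> 1" "k \<le> n"
  shows "threshold_value \<alpha> (real k / real n) - harm n / real n
    \<le> success_prob \<alpha> n v (signal_threshold_policy k)"
proof -
  let ?e = "\<lambda>i. \<alpha> / (\<alpha> + 1) + (real k / real i) powr (\<alpha> + 1) / (\<alpha> + 1)"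
  have bound: "?e i - 1 / real i \<le> (\<Sum>s=1..i. pmf (signal_pmf \<alpha> i) s * ((real (max s k) - 1) / real i))"
    if i: "i \<in> {max 1 k..n}" for i
  proof -
    have "(\<Sum>s=1..i. pmf (signal_pmf \<alpha> i) s) \<le> 1"
      using measure_pmf.prob_le_1[of "signal_pmf \<alpha> i" "{1..i}"] by (simp add: measure_measure_pmf_finite)
    then have "?e i - 1 / real i \<le> (\<Sum>s=1..i. pmf (signal_pmf \<alpha> i) s * real (max s k)) / real i
        - (\<Sum>s=1..i. pmf (signal_pmf \<alpha> i) s) / real i"
      using expectation_max_signal_ge[OF assms(1), of k i] i by (intro diff_mono divide_right_mono) auto
    also have "\<dots> = (\<Sum>s=1..i. pmf (signal_pmf \<alpha> i) s * ((real (max s k) - 1) / real i))"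
      unfolding diff_divide_distrib[symmetric] sum_subtractf[symmetric] sum_divide_distrib
      by (simp only: right_diff_distrib times_divide_eq_right mult_1_right)
    finally show ?thesis .
  qed
  have "(\<Sum>i=max 1 k..n. 1 / real i) \<le> (\<Sum>i=1..n. 1 / real i)" by (intro sum_mono2) auto
  also have "\<dots> = harm n" by (simp add: harm_def inverse_eq_divide)
  finally have harm: "(\<Sum>i=max 1 k..n. 1 / real i) \<le> harm n" .
  have "threshold_value \<alpha> (real k / real n) - harm n / real n
      \<le> (\<Sum>i=max 1 k..n. ?e i) / real n - (\<Sum>i=max 1 k..n. 1 / real i) / real n"
    using average_threshold_ge[OF assms(1,4)] harm assms(3) by (intro diff_mono divide_right_mono) auto
  also have "\<dots> = (\<Sum>i=max 1 k..n. ?e i - 1 / real i) / real n"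
    by (simp only: diff_divide_distrib sum_subtractf)
  also have "\<dots> \<le> (\<Sum>i=max 1 k..n. \<Sum>s=1..i. pmf (signal_pmf \<alpha> i) s * ((real (max s k) - 1) / real i)) / real n"
    by (intro divide_right_mono sum_mono bound) auto
  also have "\<dots> \<le> success_prob \<alpha> n v (signal_threshold_policy k)"
    using assms by (intro success_prob_ge_sum)
  finally show ?thesis .
qed

text \<open>The difference of \<open>harm n\<close> and ln n converges to the Euler-Mascheroni
  constant, and ln n / n tends to 0.\<close>

lemma harm_div_tendsto_0: "(\<lambda>n. harm n / real n) \<longlonglongrightarrow> 0"
proof -
  have "(\<lambda>n. (harm n - ln (real n)) * (1 / real n) + ln (real n) / real n) \<longlonglongrightarrow> euler_mascheroni * 0 + 0"
    by (intro tendsto_intros euler_mascheroni_LIMSEQ lim_1_over_n lim_ln_over_n)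
  then show ?thesis by (simp add: left_diff_distrib flip: add_divide_distrib diff_divide_distrib)
qed

lemma ceiling_mult_div_tendsto:
  fixes b :: real
  shows "(\<lambda>n. real_of_int \<lceil>b * real n\<rceil> / real n) \<longlonglongrightarrow> b"
proof (rule tendsto_sandwich)
  show "\<forall>\<^sub>F n in sequentially. b \<le> real_of_int \<lceil>b * real n\<rceil> / real n"
    using eventually_gt_at_top[of 0] by eventually_elim (simp add: pos_le_divide_eq)
  show "\<forall>\<^sub>F n in sequentially. real_of_int \<lceil>b * real n\<rceil> / real n \<le> b + 1 / real n"
    using eventually_gt_at_top[of 0]
  proof eventually_elim
    case (elim n)
    then show ?case using ceiling_correct[of "b * real n"] by (simp add: field_simps)
  qed
  have "(\<lambda>n. b + 1 / real n) \<longlonglongrightarrow> b + 0" by (intro tendsto_intros lim_1_over_n)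
  then show "(\<lambda>n. b + 1 / real n) \<longlonglongrightarrow> b" by simp
qed simp

theorem theorem3:
  fixes \<alpha> \<gamma> :: real and v :: "nat \<Rightarrow> nat \<Rightarrow> real"
  assumes "\<alpha> > 0" and "\<gamma> > 0"
    and "\<And>n. inj_on (v n) {1..n}"
  shows "liminf (\<lambda>n. ereal (success_prob \<alpha> n (v n)
             (signal_threshold_policy (nat \<lceil>beta_star \<gamma> * real n\<rceil>)))) \<ge> ereal (guarantee \<alpha> \<gamma>)
    \<and> (\<gamma> \<le> \<alpha> \<longrightarrow> guarantee \<alpha> \<gamma> \<ge> OPT \<gamma> \<and> OPT \<gamma> \<ge> 1 / exp 1)"
proof (intro conjI impI)
  define k where "k n = nat \<lceil>beta_star \<gamma> * real n\<rceil>" for n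
  note b = beta_star_bounds[OF assms(2)]
  have k_le: "k n \<le> n" for n
    using b by (simp add: k_def ceiling_le_iff mult_left_le_one_le)
  \<comment> \<open>The conversion by \<open>nat\<close> loses nothing since
    \<open>beta_star\<close> is nonnegative.\<close>
  have "(\<lambda>n. real (k n) / real n) \<longlonglongrightarrow> beta_star \<gamma>"
    using ceiling_mult_div_tendsto[of "beta_star \<gamma>"] b by (simp add: k_def)
  \<comment> \<open>The limit may be 0, when \<gamma> \<ge> 1; the power is still continuous there
    because its exponent \<alpha> + 1 is positive.\<close>
  then have "(\<lambda>n. threshold_value \<alpha> (real (k n) / real n)) \<longlonglongrightarrow> threshold_value \<alpha> (beta_star \<gamma>)"
    unfolding threshold_value_def using assms(1) by (intro tendsto_intros) auto
  then have "(\<lambda>n. threshold_value \<alpha> (real (k n) / real n) - harm n / real n) \<longlonglongrightarrow> guarantee \<alpha> \<gamma> - 0"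
    unfolding guarantee_eq_threshold_value[OF assms(2)] by (intro tendsto_diff harm_div_tendsto_0)
  then have "liminf (\<lambda>n. ereal (threshold_value \<alpha> (real (k n) / real n) - harm n / real n)) = ereal (guarantee \<alpha> \<gamma>)"
    by (intro lim_imp_Liminf) auto
  moreover have "liminf (\<lambda>n. ereal (threshold_value \<alpha> (real (k n) / real n) - harm n / real n))
      \<le> liminf (\<lambda>n. ereal (success_prob \<alpha> n (v n) (signal_threshold_policy (k n))))"
  proof (rule Liminf_mono)
    show "\<forall>\<^sub>F n in sequentially. ereal (threshold_value \<alpha> (real (k n) / real n) - harm n / real n)
        \<le> ereal (success_prob \<alpha> n (v n) (signal_threshold_policy (k n)))"
      using eventually_ge_at_top[of 1]
      by eventually_elim (simp add: success_prob_ge_threshold_value[OF assms(1,3) _ k_le])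
  qed
  ultimately show "ereal (guarantee \<alpha> \<gamma>) \<le> liminf (\<lambda>n. ereal (success_prob \<alpha> n (v n)
      (signal_threshold_policy (nat \<lceil>beta_star \<gamma> * real n\<rceil>))))"
    by (simp add: k_def)
qed (use assms OPT_le_guarantee OPT_ge_inverse_exp_1 in auto)

end
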